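(* Let $P$ be a finite set of atomic propositions, $T>0$, $\mathbb{T}=[0,T]\subseteq\mathbb{R}_{\ge 0}$, and let $x:\mathbb{T}\to 2^P$ be a continuous-time signal. For every MTL formula $\varphi$ (grammar in the context, with intervals $\langle a,b\rangle$, $a,b\in\mathbb{N}$, $0\le a\le b$, each end open or closed, non-empty) and every $i\in\mathbb{T}$: $(x,i)\models_L\varphi \iff (x,i)\models_C\varphi$.
   Context: For $p\in P$, $x_p(i)=1$ iff $p\in x(i)$, else $0$. Formulas: $\varphi ::= p \mid \neg\varphi \mid \varphi_1\vee\varphi_2 \mid \varphi_1 U_I\varphi_2 \mid \varphi_1 S_I \varphi_2 \mid F_I\varphi\mid G_I\varphi\mid P_I\varphi\mid H_I\varphi$. Classical semantics $\models_C$: $(x,i)\models p$ iff $x_p(i)=1$; $\neg,\vee$ as usual; $(x,i)\models\varphi U_I\psi$ iff $\exists j\in(i+I)\cap\mathbb{T}$ with $(x,j)\models\psi$ and $(x,k)\models\varphi$ for all real $k\in(i,j)$; $(x,i)\models\varphi S_I\psi$ iff $\exists j\in(i-I)\cap\mathbb{T}$ with $(x,j)\models\psi$ and $(x,k)\models\varphi$ for all $k\in(j,i)$; $F_I\varphi$: $\exists j\in(i+I)\cap\mathbb{T}$ with $(x,j)\models\varphi$; $G_I\varphi$: for all such $j$; $P_I\varphi$: $\exists j\in(i-I)\cap\mathbb{T}$; $H_I\varphi$: for all $j\in(i-I)\cap\mathbb{T}$. LTI-filtering semantics $\models_L$ (values in $\{0,1\}$, max–min dioid, windows unnormalized): for an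 interval $I=\langle a,b\rangle$ (possibly empty or a single point) let $w^+_I(t)=1$ if $t\in\langle -b,-a\rangle$ and $0$ otherwise, and $w^-_I(t)=1$ if $t\in I$ and $0$ otherwise. Then $(x,i)\models_L p=x_p(i)$; $\neg\varphi\mapsto 1-$value; $\vee\mapsto\max$; $(x,i)\models_L F_I\varphi=\sup_{j\in\mathbb{T}}\min((x,j)\models_L\varphi,\,w^+_I(i-j))$; $(x,i)\models_L G_I\varphi=1-((x,i)\models_L F_I\neg\varphi)$; $(x,i)\models_L P_I\varphi=\sup_{j\in\mathbb{T}}\min((x,j)\models_L\varphi,\,w^-_I(i-j))$; $(x,i)\models_L H_I\varphi=1-((x,i)\models_L P_I\neg\varphi)$; $(x,i)\models_L\varphi U_I\psi=\sup_{j\in I}\min((x,i)\models_L G_{(0,j)}\varphi,\ (x,i)\models_L F_{[j,j]}\psi)$; $(x,i)\models_L\varphi S_I\psi=\sup_{j\in I}\min((x,i)\models_L H_{(0,j)}\varphi,\ (x,i)\models_L P_{[j,j]}\psi)$. "$(x,i)\models_L\varphi$" means the value is $1$. *)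

theory Defs
  imports Complex_Main
begin

datatype bracket = Closed | Opened

text \<open>\<open>Ivl l a b r\<close> is the interval \<open>\<langle>a, b\<rangle>\<close> with independent bracket kinds \<open>l\<close> and \<open>r\<close>.
  Formulas carry natural endpoints; the windows of the filtering semantics also need
  real endpoints and possibly empty intervals such as \<open>(0, 0)\<close>.\<close>

datatype 'a interval = Ivl bracket 'a 'a bracket

primrec ivl_set :: "real interval \<Rightarrow> real set" where
  "ivl_set (Ivl l a b r) =
     {t. (case l of Closed \<Rightarrow> a \<le> t | Opened \<Rightarrow> a < t) \<and>
         (case r of Closed \<Rightarrow> t \<le> b | Opened \<Rightarrow> t < b)}"

abbreviation real_ivl :: "nat interval \<Rightarrow> real interval" where
  "real_ivl \<equiv> map_interval real"

datatype 'p mtl =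
    Atom 'p
  | Neg "'p mtl"
  | Disj "'p mtl" "'p mtl"
  | Until "'p mtl" "nat interval" "'p mtl"
  | Since "'p mtl" "nat interval" "'p mtl"
  | Finally "nat interval" "'p mtl"
  | Globally "nat interval" "'p mtl"
  | Previously "nat interval" "'p mtl"
  | Historically "nat interval" "'p mtl"

text \<open>Non-emptiness of the real interval \<open>\<langle>a, b\<rangle>\<close> already entails \<open>a \<le> b\<close>.\<close>

primrec mtl_over :: "'p set \<Rightarrow> 'p mtl \<Rightarrow> bool" where
  "mtl_over P (Atom p) \<longleftrightarrow> p \<in> P"
| "mtl_over P (Neg \<phi>) \<longleftrightarrow> mtl_over P \<phi>"
| "mtl_over P (Disj \<phi> \<psi>) \<longleftrightarrow> mtl_over P \<phi> \<and> mtl_over P \<psi>"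
| "mtl_over P (Until \<phi> I \<psi>) \<longleftrightarrow>
     ivl_set (real_ivl I) \<noteq> {} \<and> mtl_over P \<phi> \<and> mtl_over P \<psi>"
| "mtl_over P (Since \<phi> I \<psi>) \<longleftrightarrow>
     ivl_set (real_ivl I) \<noteq> {} \<and> mtl_over P \<phi> \<and> mtl_over P \<psi>"
| "mtl_over P (Finally I \<phi>) \<longleftrightarrow> ivl_set (real_ivl I) \<noteq> {} \<and> mtl_over P \<phi>"
| "mtl_over P (Globally I \<phi>) \<longleftrightarrow> ivl_set (real_ivl I) \<noteq> {} \<and> mtl_over P \<phi>"
| "mtl_over P (Previously I \<phi>) \<longleftrightarrow> ivl_set (real_ivl I) \<noteq> {} \<and> mtl_over P \<phi>"
| "mtl_over P (Historically I \<phi>) \<longleftrightarrow> ivl_set (real_ivl I) \<noteq> {} \<and> mtl_over P \<phi>"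

text \<open>A signal on the time domain \<open>{0..T}\<close> is a function on the reals whose values outside
  \<open>{0..T}\<close> are never consulted at times \<open>i \<in> {0..T}\<close>.\<close>

definition atom_val :: "(real \<Rightarrow> 'p set) \<Rightarrow> 'p \<Rightarrow> real \<Rightarrow> real" where
  "atom_val x p i = (if p \<in> x i then 1 else 0)"

definition fut :: "real \<Rightarrow> real \<Rightarrow> real interval \<Rightarrow> real set" where
  "fut T i I = (\<lambda>t. i + t) ` ivl_set I \<inter> {0..T}"

definition past :: "real \<Rightarrow> real \<Rightarrow> real interval \<Rightarrow> real set" where
  "past T i I = (\<lambda>t. i - t) ` ivl_set I \<inter> {0..T}"

primrec sat_C :: "real \<Rightarrow> (real \<Rightarrow> 'p set) \<Rightarrow> real \<Rightarrow> 'p mtl \<Rightarrow> bool" where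
  "sat_C T x i (Atom p) \<longleftrightarrow> atom_val x p i = 1"
| "sat_C T x i (Neg \<phi>) \<longleftrightarrow> \<not> sat_C T x i \<phi>"
| "sat_C T x i (Disj \<phi> \<psi>) \<longleftrightarrow> sat_C T x i \<phi> \<or> sat_C T x i \<psi>"
| "sat_C T x i (Until \<phi> I \<psi>) \<longleftrightarrow>
     (\<exists>j \<in> fut T i (real_ivl I). sat_C T x j \<psi> \<and> (\<forall>k \<in> {i<..<j}. sat_C T x k \<phi>))"
| "sat_C T x i (Since \<phi> I \<psi>) \<longleftrightarrow>
     (\<exists>j \<in> past T i (real_ivl I). sat_C T x j \<psi> \<and> (\<forall>k \<in> {j<..<i}. sat_C T x k \<phi>))"
| "sat_C T x i (Finally I \<phi>) \<longleftrightarrow> (\<exists>j \<in> fut T i (real_ivl I). sat_C T x j \<phi>)"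
| "sat_C T x i (Globally I \<phi>) \<longleftrightarrow> (\<forall>j \<in> fut T i (real_ivl I). sat_C T x j \<phi>)"
| "sat_C T x i (Previously I \<phi>) \<longleftrightarrow> (\<exists>j \<in> past T i (real_ivl I). sat_C T x j \<phi>)"
| "sat_C T x i (Historically I \<phi>) \<longleftrightarrow> (\<forall>j \<in> past T i (real_ivl I). sat_C T x j \<phi>)"

text \<open>The reflected interval \<open>\<langle>-b, -a\<rangle>\<close> keeps each bracket with its endpoint:
  \<open>[a, b)\<close> becomes \<open>(-b, -a]\<close>.\<close>

primrec reflect_ivl :: "real interval \<Rightarrow> real interval" where
  "reflect_ivl (Ivl l a b r) = Ivl r (- b) (- a) l"

definition w_plus :: "real interval \<Rightarrow> real \<Rightarrow> real" where
  "w_plus I t = (if t \<in> ivl_set (reflect_ivl I) then 1 else 0)"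

definition w_minus :: "real interval \<Rightarrow> real \<Rightarrow> real" where
  "w_minus I t = (if t \<in> ivl_set I then 1 else 0)"

text \<open>Filtering operators acting on value functions (time to truth value), so that they apply
  both to the intervals of formulas and to the real-endpoint intervals \<open>(0, j)\<close> and \<open>[j, j]\<close>
  in the clauses for until and since.\<close>

definition filt_F :: "real \<Rightarrow> real interval \<Rightarrow> (real \<Rightarrow> real) \<Rightarrow> real \<Rightarrow> real" where
  "filt_F T I f i = (SUP j \<in> {0..T}. min (f j) (w_plus I (i - j)))"

definition filt_G :: "real \<Rightarrow> real interval \<Rightarrow> (real \<Rightarrow> real) \<Rightarrow> real \<Rightarrow> real" where
  "filt_G T I f i = 1 - filt_F T I (\<lambda>j. 1 - f j) i"

definition filt_P :: "real \<Rightarrow> real interval \<Rightarrow> (real \<Rightarrow> real) \<Rightarrow> real \<Rightarrow> real" where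
  "filt_P T I f i = (SUP j \<in> {0..T}. min (f j) (w_minus I (i - j)))"

definition filt_H :: "real \<Rightarrow> real interval \<Rightarrow> (real \<Rightarrow> real) \<Rightarrow> real \<Rightarrow> real" where
  "filt_H T I f i = 1 - filt_P T I (\<lambda>j. 1 - f j) i"

primrec val_L :: "real \<Rightarrow> (real \<Rightarrow> 'p set) \<Rightarrow> 'p mtl \<Rightarrow> real \<Rightarrow> real" where
  "val_L T x (Atom p) = atom_val x p"
| "val_L T x (Neg \<phi>) = (\<lambda>i. 1 - val_L T x \<phi> i)"
| "val_L T x (Disj \<phi> \<psi>) = (\<lambda>i. max (val_L T x \<phi> i) (val_L T x \<psi> i))"
| "val_L T x (Until \<phi> I \<psi>) =
     (\<lambda>i. SUP j \<in> ivl_set (real_ivl I).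
        min (filt_G T (Ivl Opened 0 j Opened) (val_L T x \<phi>) i)
            (filt_F T (Ivl Closed j j Closed) (val_L T x \<psi>) i))"
| "val_L T x (Since \<phi> I \<psi>) =
     (\<lambda>i. SUP j \<in> ivl_set (real_ivl I).
        min (filt_H T (Ivl Opened 0 j Opened) (val_L T x \<phi>) i)
            (filt_P T (Ivl Closed j j Closed) (val_L T x \<psi>) i))"
| "val_L T x (Finally I \<phi>) = filt_F T (real_ivl I) (val_L T x \<phi>)"
| "val_L T x (Globally I \<phi>) = filt_G T (real_ivl I) (val_L T x \<phi>)"
| "val_L T x (Previously I \<phi>) = filt_P T (real_ivl I) (val_L T x \<phi>)"
| "val_L T x (Historically I \<phi>) = filt_H T (real_ivl I) (val_L T x \<phi>)"

definition sat_L :: "real \<Rightarrow> (real \<Rightarrow> 'p set) \<Rightarrow> real \<Rightarrow> 'p mtl \<Rightarrow> bool" where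
  "sat_L T x i \<phi> \<longleftrightarrow> val_L T x \<phi> i = 1"

end

theory Submission
  imports Defs
begin

text \<open>All values of the filtering semantics lie in \<open>{0, 1}\<close>, so over a non-empty index set a
  supremum is an existential quantifier, and the windows restrict it to \<open>i + I\<close> or \<open>i - I\<close>.
  Until and since agree because \<open>F\<close> over \<open>[j, j]\<close> evaluates its argument at the single time
  \<open>i + j\<close>, which forces \<open>i + j \<le> T\<close>, so that cutting \<open>i + (0, j)\<close> down to the time domain loses
  nothing.\<close>

lemma SUP_of_bool:
  assumes "A \<noteq> {}" and "\<And>j. j \<in> A \<Longrightarrow> f j = of_bool (Q j)"
  shows "(SUP j\<in>A. f j :: real) = of_bool (\<exists>j\<in>A. Q j)"
proof (cases "\<exists>j\<in>A. Q j")
  case True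
  then obtain j where "j \<in> A" "f j = 1"
    using assms(2) by auto
  then have "Sup (f ` A) = 1"
    by (intro cSup_eq_maximum) (auto simp: assms(2) intro: rev_image_eqI)
  with True show ?thesis by simp
next
  case False
  \<comment> \<open>This needs \<open>A\<close> to be non-empty: the real supremum of the empty set
    is unspecified and cannot be taken to be 0.\<close>
  then have "f ` A = {0}"
    using assms by force
  with False show ?thesis by simp
qed

lemma fut_iff: "j \<in> fut T i I \<longleftrightarrow> j \<in> {0..T} \<and> j - i \<in> ivl_set I"
  unfolding fut_def by (auto intro: rev_image_eqI)

lemma past_iff: "j \<in> past T i I \<longleftrightarrow> j \<in> {0..T} \<and> i - j \<in> ivl_set I"
  unfolding past_def by (auto intro: rev_image_eqI)

text \<open>Negating \<open>t\<close> undoes the reflection, brackets included; at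
  \<open>t = i - j\<close> the window tests whether the delay \<open>j - i\<close> lies in
  \<open>I\<close>.\<close>

lemma w_plus_eq: "w_plus I t = of_bool (- t \<in> ivl_set I)"
  by (cases I) (auto simp: w_plus_def split: bracket.splits)

lemma w_minus_eq: "w_minus I t = of_bool (t \<in> ivl_set I)"
  by (simp add: w_minus_def)

lemma min_of_bool: "min (of_bool p) (of_bool q) = (of_bool (p \<and> q) :: real)"
  by auto

text \<open>The supremum runs over the time domain, non-empty by \<open>0 \<le> T\<close>, so
  \<open>I\<close> itself may be empty, as the window \<open>(0, 0)\<close> is. Values of
  \<open>f\<close> are prescribed only on \<open>{0..T}\<close>, which is all that the induction
  provides.\<close>

lemma filt_F_of_bool:
  assumes "0 \<le> T" and "\<And>j. j \<in> {0..T} \<Longrightarrow> f j = of_bool (Q j)"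
  shows "filt_F T I f i = of_bool (\<exists>j \<in> fut T i I. Q j)"
proof -
  have "filt_F T I f i = of_bool (\<exists>j\<in>{0..T}. Q j \<and> j - i \<in> ivl_set I)"
    unfolding filt_F_def
    by (rule SUP_of_bool) (use assms in \<open>auto simp: w_plus_eq\<close>)
  also have "(\<exists>j\<in>{0..T}. Q j \<and> j - i \<in> ivl_set I) \<longleftrightarrow> (\<exists>j \<in> fut T i I. Q j)"
    by (auto simp: fut_iff)
  finally show ?thesis .
qed

lemma filt_P_of_bool:
  assumes "0 \<le> T" and "\<And>j. j \<in> {0..T} \<Longrightarrow> f j = of_bool (Q j)"
  shows "filt_P T I f i = of_bool (\<exists>j \<in> past T i I. Q j)"
proof -
  have "filt_P T I f i = of_bool (\<exists>j\<in>{0..T}. Q j \<and> i - j \<in> ivl_set I)"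
    unfolding filt_P_def
    by (rule SUP_of_bool) (use assms in \<open>auto simp: w_minus_eq\<close>)
  also have "(\<exists>j\<in>{0..T}. Q j \<and> i - j \<in> ivl_set I) \<longleftrightarrow> (\<exists>j \<in> past T i I. Q j)"
    by (auto simp: past_iff)
  finally show ?thesis .
qed

lemma filt_G_of_bool:
  assumes "0 \<le> T" and "\<And>j. j \<in> {0..T} \<Longrightarrow> f j = of_bool (Q j)"
  shows "filt_G T I f i = of_bool (\<forall>j \<in> fut T i I. Q j)"
proof -
  have "filt_F T I (\<lambda>j. 1 - f j) i = of_bool (\<exists>j \<in> fut T i I. \<not> Q j)"
    by (rule filt_F_of_bool) (use assms in auto)
  then show ?thesis
    by (auto simp: filt_G_def)
qed

lemma filt_H_of_bool:
  assumes "0 \<le> T" and "\<And>j. j \<in> {0..T} \<Longrightarrow> f j = of_bool (Q j)"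
  shows "filt_H T I f i = of_bool (\<forall>j \<in> past T i I. Q j)"
proof -
  have "filt_P T I (\<lambda>j. 1 - f j) i = of_bool (\<exists>j \<in> past T i I. \<not> Q j)"
    by (rule filt_P_of_bool) (use assms in auto)
  then show ?thesis
    by (auto simp: filt_H_def)
qed

text \<open>The bound \<open>j\<close> is a delay on the left and a time on the right; the window
  \<open>[j, j]\<close> ties them by \<open>k = i + j\<close>. For delays \<open>j \<le> 0\<close>
  both universal conditions are vacuous.\<close>

lemma until_windows_iff:
  assumes "i \<in> {0..T}"
  shows "(\<exists>j \<in> ivl_set I. (\<forall>k \<in> fut T i (Ivl Opened 0 j Opened). A k) \<and>
            (\<exists>k \<in> fut T i (Ivl Closed j j Closed). B k)) \<longleftrightarrow>
         (\<exists>j \<in> fut T i I. B j \<and> (\<forall>k \<in> {i<..<j}. A k))"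
    (is "?L \<longleftrightarrow> ?R")
proof
  assume ?L
  then obtain j k where j: "j \<in> ivl_set I" "k - i = j" "k \<in> {0..T}" "B k"
    and A: "\<forall>k \<in> fut T i (Ivl Opened 0 j Opened). A k"
    by (auto simp: fut_iff)
  have "k \<in> fut T i I" using j by (simp add: fut_iff)
  \<comment> \<open>By convexity, every time between \<open>i\<close> and \<open>k\<close> lies in
    \<open>{0..T}\<close> because both ends do.\<close>
  moreover have "\<forall>k' \<in> {i<..<k}. A k'"
    using A j assms by (auto simp: fut_iff)
  ultimately show ?R using j by blast
next
  assume ?R
  then obtain j where j: "j \<in> {0..T}" "j - i \<in> ivl_set I" "B j" "\<forall>k \<in> {i<..<j}. A k"
    by (auto simp: fut_iff)
  show ?L
    by (rule bexI[of _ "j - i"]) (use j in \<open>auto simp: fut_iff\<close>)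
qed

text \<open>Time reversal of \<open>until_windows_iff\<close>, with
  \<open>k = i - j\<close>.\<close>

lemma since_windows_iff:
  assumes "i \<in> {0..T}"
  shows "(\<exists>j \<in> ivl_set I. (\<forall>k \<in> past T i (Ivl Opened 0 j Opened). A k) \<and>
            (\<exists>k \<in> past T i (Ivl Closed j j Closed). B k)) \<longleftrightarrow>
         (\<exists>j \<in> past T i I. B j \<and> (\<forall>k \<in> {j<..<i}. A k))"
    (is "?L \<longleftrightarrow> ?R")
proof
  assume ?L
  then obtain j k where j: "j \<in> ivl_set I" "i - k = j" "k \<in> {0..T}" "B k"
    and A: "\<forall>k \<in> past T i (Ivl Opened 0 j Opened). A k"
    by (auto simp: past_iff)
  have "k \<in> past T i I" using j by (simp add: past_iff)
  moreover have "\<forall>k' \<in> {k<..<i}. A k'"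
    using A j assms by (auto simp: past_iff)
  ultimately show ?R using j by blast
next
  assume ?R
  then obtain j where j: "j \<in> {0..T}" "i - j \<in> ivl_set I" "B j" "\<forall>k \<in> {j<..<i}. A k"
    by (auto simp: past_iff)
  show ?L
    by (rule bexI[of _ "i - j"]) (use j in \<open>auto simp: past_iff\<close>)
qed

text \<open>Agreement at value 1 alone would not survive negation, so the induction carries the
  exact value, and for all times in the domain at once.\<close>

lemma val_L_eq_of_bool_sat_C:
  assumes "0 \<le> T" and "mtl_over P \<phi>" and "i \<in> {0..T}"
  shows "val_L T x \<phi> i = of_bool (sat_C T x i \<phi>)"
  using assms(2,3)
proof (induction \<phi> arbitrary: i)
  case (Until \<phi> I \<psi>)
  \<comment> \<open>Here the supremum runs over the interval of the formula, and
    \<open>mtl_over\<close> supplies the non-emptiness that \<open>SUP_of_bool\<close>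
    requires.\<close>
  have "val_L T x (Until \<phi> I \<psi>) i = of_bool (\<exists>j \<in> ivl_set (real_ivl I).
      (\<forall>k \<in> fut T i (Ivl Opened 0 j Opened). sat_C T x k \<phi>) \<and>
      (\<exists>k \<in> fut T i (Ivl Closed j j Closed). sat_C T x k \<psi>))"
    unfolding val_L.simps using Until assms(1)
    by (intro SUP_of_bool)
      (simp_all only: mtl_over.simps filt_G_of_bool filt_F_of_bool min_of_bool not_False_eq_True)
  then show ?case
    using until_windows_iff[OF Until.prems(2)] by simp
next
  case (Since \<phi> I \<psi>)
  have "val_L T x (Since \<phi> I \<psi>) i = of_bool (\<exists>j \<in> ivl_set (real_ivl I).
      (\<forall>k \<in> past T i (Ivl Opened 0 j Opened). sat_C T x k \<phi>) \<and>
      (\<exists>k \<in> past T i (Ivl Closed j j Closed). sat_C T x k \<psi>))"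
    unfolding val_L.simps using Since assms(1)
    by (intro SUP_of_bool)
      (simp_all only: mtl_over.simps filt_H_of_bool filt_P_of_bool min_of_bool not_False_eq_True)
  then show ?case
    using since_windows_iff[OF Since.prems(2)] by simp
next
  case (Finally I \<phi>)
  with assms(1) show ?case
    by (simp del: atLeastAtMost_iff add: filt_F_of_bool[where Q = "\<lambda>j. sat_C T x j \<phi>"])
next
  case (Globally I \<phi>)
  with assms(1) show ?case
    by (simp del: atLeastAtMost_iff add: filt_G_of_bool[where Q = "\<lambda>j. sat_C T x j \<phi>"])
next
  case (Previously I \<phi>)
  with assms(1) show ?case
    by (simp del: atLeastAtMost_iff add: filt_P_of_bool[where Q = "\<lambda>j. sat_C T x j \<phi>"])
next
  case (Historically I \<phi>)
  with assms(1) show ?case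
    by (simp del: atLeastAtMost_iff add: filt_H_of_bool[where Q = "\<lambda>j. sat_C T x j \<phi>"])
qed (auto simp: atom_val_def)

theorem theorem2:
  fixes P :: "'p set" and T :: real and x :: "real \<Rightarrow> 'p set"
    and \<phi> :: "'p mtl" and i :: real
  assumes "finite P"
    and "T > 0"
    and "\<forall>t \<in> {0..T}. x t \<subseteq> P"
    and "mtl_over P \<phi>"
    and "i \<in> {0..T}"
  shows "sat_L T x i \<phi> \<longleftrightarrow> sat_C T x i \<phi>"
  using val_L_eq_of_bool_sat_C[of T P \<phi> i x] assms by (simp add: sat_L_def)

end
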